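(* Let $G$ be a connected graph with minimum degree at least $2$, and let $Q\in\mathbb{R}^{k\times k}$ be an orthogonal matrix with no integral rows. Suppose that there is a graph $H$ not isomorphic to $G$ that is obtained from $G$ by a $Q$-switching. Then $G$ has a connected subgraph with at most $2k+1$ vertices and strictly more edges than vertices.
   Context: Graphs are finite and simple, on vertex set $V$ with $|V|=n\ge k$. A row of a matrix is integral if all its entries are integers. $Q$-switching: a graph $H$ (on the same vertex set) is obtained from $G$ by a $Q$-switching with switching set $X\subseteq V$, $|X|=k$, if after ordering the vertices with $X$ first, $A_H=M^{T}A_GM$ where $M=\operatorname{diag}(Q,-I_a,I_b)$ is block diagonal with $a+b=n-k$ and $A_G,A_H$ are the adjacency matrices. *)

theory Defs
  imports Complex_Main
begin

text \<open>A finite simple graph on vertex set V, edges are 2-element subsets of V.\<close>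
definition simple_graph :: "'a set \<Rightarrow> 'a set set \<Rightarrow> bool" where
  "simple_graph V E \<longleftrightarrow> finite V \<and> E \<subseteq> {{u, v} | u v. u \<in> V \<and> v \<in> V \<and> u \<noteq> v}"

definition adj_rel :: "'a set set \<Rightarrow> ('a \<times> 'a) set" where
  "adj_rel E = {(u, v). {u, v} \<in> E}"

definition connected_graph :: "'a set \<Rightarrow> 'a set set \<Rightarrow> bool" where
  "connected_graph V E \<longleftrightarrow> V \<noteq> {} \<and> (\<forall>u\<in>V. \<forall>v\<in>V. (u, v) \<in> (adj_rel E)\<^sup>*)"

definition degree :: "'a set \<Rightarrow> 'a set set \<Rightarrow> 'a \<Rightarrow> nat" where
  "degree V E v = card {u \<in> V. {u, v} \<in> E}"

definition min_degree_ge :: "'a set \<Rightarrow> 'a set set \<Rightarrow> nat \<Rightarrow> bool" where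
  "min_degree_ge V E d \<longleftrightarrow> (\<forall>v\<in>V. d \<le> degree V E v)"

text \<open>Adjacency matrix, indexed by vertices.\<close>
definition adj_mat :: "'a set set \<Rightarrow> 'a \<Rightarrow> 'a \<Rightarrow> real" where
  "adj_mat E u v = (if {u, v} \<in> E then 1 else 0)"

text \<open>Q is a k x k real matrix (indices 0..k-1).\<close>
definition orthogonal_mat :: "nat \<Rightarrow> (nat \<Rightarrow> nat \<Rightarrow> real) \<Rightarrow> bool" where
  "orthogonal_mat k Q \<longleftrightarrow>
     (\<forall>i<k. \<forall>j<k. (\<Sum>l<k. Q l i * Q l j) = (if i = j then 1 else 0))"

definition integral_row :: "nat \<Rightarrow> (nat \<Rightarrow> nat \<Rightarrow> real) \<Rightarrow> nat \<Rightarrow> bool" where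
  "integral_row k Q i \<longleftrightarrow> (\<forall>j<k. Q i j \<in> \<int>)"

definition no_integral_rows :: "nat \<Rightarrow> (nat \<Rightarrow> nat \<Rightarrow> real) \<Rightarrow> bool" where
  "no_integral_rows k Q \<longleftrightarrow> (\<forall>i<k. \<not> integral_row k Q i)"

text \<open>The switching matrix M = diag(Q, -I_a, I_b), indexed by vertices: the vertices of X are
  ordered by the bijection sigma : {0..<k} -> X, A gets sign -1, B gets sign +1.\<close>
definition switch_mat ::
  "(nat \<Rightarrow> nat \<Rightarrow> real) \<Rightarrow> 'a set \<Rightarrow> (nat \<Rightarrow> 'a) \<Rightarrow> 'a set \<Rightarrow> 'a set \<Rightarrow> 'a \<Rightarrow> 'a \<Rightarrow> real" where
  "switch_mat Q X \<sigma> A B x y =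
     (if x \<in> X \<and> y \<in> X then Q (inv_into {..<card X} \<sigma> x) (inv_into {..<card X} \<sigma> y)
      else if x = y \<and> x \<in> A then -1
      else if x = y \<and> x \<in> B then 1
      else 0)"

definition Q_switching ::
  "nat \<Rightarrow> (nat \<Rightarrow> nat \<Rightarrow> real) \<Rightarrow> 'a set \<Rightarrow> 'a set set \<Rightarrow> 'a set set \<Rightarrow> bool" where
  "Q_switching k Q V EG EH \<longleftrightarrow>
     (\<exists>X \<sigma> A B. X \<subseteq> V \<and> card X = k \<and> bij_betw \<sigma> {..<k} X \<and>
        A \<inter> B = {} \<and> A \<union> B = V - X \<and>
        (\<forall>u\<in>V. \<forall>w\<in>V. adj_mat EH u w =
           (\<Sum>x\<in>V. \<Sum>y\<in>V. switch_mat Q X \<sigma> A B x u * adj_mat EG x y * switch_mat Q X \<sigma> A B y w)))"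

definition graph_isomorphic :: "'a set \<Rightarrow> 'a set set \<Rightarrow> 'a set set \<Rightarrow> bool" where
  "graph_isomorphic V EG EH \<longleftrightarrow>
     (\<exists>f. bij_betw f V V \<and> (\<forall>u\<in>V. \<forall>v\<in>V. {u, v} \<in> EG \<longleftrightarrow> {f u, f v} \<in> EH))"

end

theory Submission
  imports Defs
begin

text \<open>
  Suppose that every subgraph on at most 2k+1 vertices has at most as many edges as vertices. A
  vertex outside the switching set X has no neighbour in X or at least two, because a single
  neighbour would make a row of Q integral. Let W be the set of vertices of the second kind.
  Counting the edges between X and k+1 vertices of W shows that W has at most k elements, so the
  subgraph induced on U = X \<union> W is sparse; its degrees are at least 2, hence it is a disjoint union
  of cycles. The switching matrix restricted to U is orthogonal, and comparing degrees with the
  spectral norm shows that H induces a disjoint union of cycles on U as well.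

  Let T_j be the polynomials with T_j(z + 1/z) = z^j + z^(-j). For the adjacency matrix of a union of
  cycles, T_j maps the indicator of v to the sum of the indicators of the two vertices reached from v
  by going j steps around its cycle. On W the switching matrix is diagonal with entries 1 and -1, so
  the entries of T_j between vertices of W agree up to sign, and being nonnegative they agree: the
  cyclic distances in W are the same in G and H. If X is not all of V then every cycle of G meets W
  by connectedness, and the cycles of G and H can be matched by an isomorphism fixing W, which extends
  by the identity. If X = V then G is a single cycle and equality of the traces of T_j forces H to
  be one too.
\<close>

definition nbrs :: "'a set \<Rightarrow> 'a set set \<Rightarrow> 'a \<Rightarrow> 'a set" where
  "nbrs U E u = {v \<in> U. {u, v} \<in> E}"

lemma sum_of_bool_eq:
  assumes "finite U" "a \<in> U"
  shows "(\<Sum>z\<in>U. f z * of_bool (z = a)) = (f a :: real)"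
    and "(\<Sum>z\<in>U. f z * of_bool (a = z)) = (f a :: real)"
    and "(\<Sum>z\<in>U. of_bool (a = z) * f z) = (f a :: real)"
  using assms by (simp_all add: of_bool_def if_distrib if_distribR cong: if_cong)

subsection \<open>Bi-infinite walks around the cycles of a 2-regular graph\<close>

locale two_regular =
  fixes U :: "'a set" and E :: "'a set set"
  assumes fin: "finite U"
    and loopfree: "u \<in> U \<Longrightarrow> {u} \<notin> E"
    and card_nbrs: "u \<in> U \<Longrightarrow> card (nbrs U E u) = 2"
begin

text \<open>A cycle is unrolled along the integers, so its length and arithmetic modulo it never
  appear. As both neighbours of \<open>c i\<close> are listed and \<open>card_nbrs\<close> makes
  them distinct, a walk cannot turn back.\<close>

definition walk :: "(int \<Rightarrow> 'a) \<Rightarrow> bool" where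
  "walk c \<longleftrightarrow> (\<forall>i. c i \<in> U \<and> nbrs U E (c i) = {c (i - 1), c (i + 1)})"

lemma walk_in: "walk c \<Longrightarrow> c i \<in> U"
  by (simp add: walk_def)

lemma walk_nbrs: "walk c \<Longrightarrow> nbrs U E (c i) = {c (i - 1), c (i + 1)}"
  by (simp add: walk_def)

lemma walk_neq2: "walk c \<Longrightarrow> c (i - 1) \<noteq> c (i + 1)"
  using card_nbrs[of "c i"] by (force simp: walk_def)

lemma walk_neq1: "walk c \<Longrightarrow> c i \<noteq> c (i + 1)"
proof
  assume c: "walk c" and eq: "c i = c (i + 1)"
  have "c (i + 1) \<in> nbrs U E (c i)" using walk_nbrs[OF c] by auto
  then show False using eq loopfree walk_in[OF c] by (auto simp: nbrs_def)
qed

lemma walk_shift: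
  assumes "walk c" shows "walk (\<lambda>i. c (m + i))"
  unfolding walk_def
proof
  fix i
  show "c (m + i) \<in> U \<and> nbrs U E (c (m + i)) = {c (m + (i - 1)), c (m + (i + 1))}"
    using walk_in[OF assms] walk_nbrs[OF assms, of "m + i"] by (simp add: algebra_simps)
qed

lemma walk_reverse:
  assumes "walk c" shows "walk (\<lambda>i. c (m - i))"
  unfolding walk_def
proof
  fix i
  show "c (m - i) \<in> U \<and> nbrs U E (c (m - i)) = {c (m - (i - 1)), c (m - (i + 1))}"
    using walk_in[OF assms] walk_nbrs[OF assms, of "m - i"]
    by (simp add: algebra_simps insert_commute)
qed

text \<open>At each vertex the known neighbour leaves one candidate for the other, so two
  consecutive values propagate in both directions.\<close>

lemma walk_determined:
  assumes c: "walk c" and d: "walk d" and "c 0 = d 0" "c 1 = d 1"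
  shows "c i = d i"
proof -
  have "c i = d i \<and> c (i + 1) = d (i + 1)"
  proof (induction i rule: int_induct[of _ 0])
    case base
    then show ?case using assms by simp
  next
    case (step1 i)
    have "{c i, c (i + 2)} = {d i, d (i + 2)}"
      using walk_nbrs[OF c, of "i + 1"] walk_nbrs[OF d, of "i + 1"] step1 by (simp add: algebra_simps)
    then have "c (i + 2) = d (i + 2)"
      using step1 by (auto simp: doubleton_eq_iff)
    then show ?case using step1 by (simp add: algebra_simps)
  next
    case (step2 i)
    have "{c (i - 1), c (i + 1)} = {d (i - 1), d (i + 1)}"
      using walk_nbrs[OF c, of i] walk_nbrs[OF d, of i] step2 by simp
    then have "c (i - 1) = d (i - 1)"
      using step2 by (auto simp: doubleton_eq_iff)
    then show ?case using step2 by simp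
  qed
  then show ?thesis ..
qed

text \<open>The only freedom is which of the two neighbours of the start comes first.\<close>

lemma walk_same_start:
  assumes c: "walk c" and d: "walk d" and 0: "c 0 = d 0"
  shows "(\<forall>i. d i = c i) \<or> (\<forall>i. d i = c (- i))"
proof -
  have "{c (- 1), c 1} = {d (- 1), d 1}"
    using walk_nbrs[OF c, of 0] walk_nbrs[OF d, of 0] 0 by simp
  then have "c 1 = d 1 \<or> c (- 1) = d 1" by (auto simp: doubleton_eq_iff)
  then show ?thesis
    using walk_determined[OF c d 0] walk_determined[OF walk_reverse[OF c, of 0] d] 0 by auto
qed

text \<open>A reflection of the integers either fixes some \<open>h\<close>, forcing
  \<open>c (h - 1) = c (h + 1)\<close>, or swaps \<open>h\<close> and \<open>h + 1\<close>, forcing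
  \<open>c h = c (h + 1)\<close>; a walk excludes both.\<close>

lemma walk_no_reflection:
  assumes c: "walk c"
  shows "\<exists>i. c i \<noteq> c (m - i)"
proof (cases "even m")
  case True
  then obtain h where "m = 2 * h" by blast
  then show ?thesis using walk_neq2[OF c, of h] by (intro exI[of _ "h - 1"]) (simp add: algebra_simps)
next
  case False
  then obtain h where "m = 2 * h + 1" by (elim oddE)
  then show ?thesis using walk_neq1[OF c, of h] by (intro exI[of _ h]) (simp add: algebra_simps)
qed

text \<open>The shifts of \<open>c\<close> by \<open>i\<close> and by \<open>j\<close> start at the
  same vertex, so they agree or are mirror images; the latter would be a reflection symmetry of
  \<open>c\<close>.\<close>

lemma walk_period:
  assumes c: "walk c" and eq: "c i = c j"
  shows "c (i + n) = c (j + n)"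
proof -
  have "(\<forall>n. c (j + n) = c (i + n)) \<or> (\<forall>n. c (j + n) = c (i + - n))"
    using walk_same_start[OF walk_shift[OF c, of i] walk_shift[OF c, of j]] eq by simp
  moreover have "\<not> (\<forall>n. c (j + n) = c (i + - n))"
  proof
    assume *: "\<forall>n. c (j + n) = c (i + - n)"
    obtain l where l: "c l \<noteq> c ((i + j) - l)" using walk_no_reflection[OF c] by blast
    show False using *[rule_format, of "l - j"] l by (simp add: algebra_simps)
  qed
  ultimately show ?thesis by metis
qed

lemma walk_eq_0_iff:
  assumes c: "walk c"
  shows "c i = c j \<longleftrightarrow> c (i - j) = c 0"
  using walk_period[OF c, of i j "- j"] walk_period[OF c, of "i - j" 0 j] by auto

lemma walk_uminus_eq_0_iff:
  assumes c: "walk c"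
  shows "c (- i) = c 0 \<longleftrightarrow> c i = c 0"
  using walk_eq_0_iff[OF c, of 0 i] by auto

lemma nat_walk_exists:
  assumes v: "v \<in> U" and a: "a \<in> nbrs U E v"
  obtains p :: "nat \<Rightarrow> 'a" where "p 0 = v" "p 1 = a" "\<And>j. p j \<in> U"
    "\<And>j. nbrs U E (p (Suc j)) = {p j, p (Suc (Suc j))}"
proof -
  \<comment> \<open>Dependent choice runs over pairs of consecutive vertices; the clause for
    \<open>n = 0\<close> fixes the first pair.\<close>
  define P where "P n x \<longleftrightarrow> fst x \<in> U \<and> snd x \<in> nbrs U E (fst x) \<and> (n = 0 \<longrightarrow> x = (v, a))"
    for n :: nat and x
  define R where "R n x y \<longleftrightarrow> fst y = snd x \<and> nbrs U E (snd x) = {fst x, snd y}"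
    for n :: nat and x y :: "'a \<times> 'a"
  have "\<exists>f. \<forall>n. P n (f n) \<and> R n (f n) (f (Suc n))"
  proof (rule dependent_nat_choice)
    show "\<exists>x. P 0 x" using v a by (auto simp: P_def)
  next
    fix x n assume "P n x"
    then have x: "fst x \<in> U" "snd x \<in> nbrs U E (fst x)" by (auto simp: P_def)
    then have s: "snd x \<in> U" "fst x \<in> nbrs U E (snd x)"
      by (auto simp: nbrs_def insert_commute)
    obtain z where "nbrs U E (snd x) = {fst x, z}"
      using card_nbrs[OF s(1)] s(2) unfolding card_2_iff by (metis doubleton_eq_iff insertE singletonD)
    then have "P (Suc n) (snd x, z) \<and> R n x (snd x, z)" using s by (auto simp: P_def R_def)
    then show "\<exists>y. P (Suc n) y \<and> R n x y" ..
  qed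
  then obtain f where f: "\<And>n. P n (f n)" "\<And>n. R n (f n) (f (Suc n))" by blast
  have f0: "f 0 = (v, a)" using f(1)[of 0] by (simp add: P_def)
  have fS: "fst (f (Suc n)) = snd (f n)" for n using f(2)[of n] by (simp add: R_def)
  show thesis
  proof (rule that[of "\<lambda>n. fst (f n)"])
    show "fst (f 0) = v" "fst (f 1) = a" using f0 fS[of 0] by auto
    show "fst (f j) \<in> U" for j using f(1)[of j] by (simp add: P_def)
    show "nbrs U E (fst (f (Suc j))) = {fst (f j), fst (f (Suc (Suc j)))}" for j
      using f(2)[of j] unfolding R_def fS by simp
  qed
qed

text \<open>Two one-sided walks leave \<open>v\<close> through its two neighbours and are glued at
  index 0.\<close>

lemma walk_exists:
  assumes v: "v \<in> U"
  obtains c where "walk c" "c 0 = v"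
proof -
  obtain a b where ab: "nbrs U E v = {a, b}" using card_nbrs[OF v] by (auto simp: card_2_iff)
  obtain p :: "nat \<Rightarrow> 'a" where p: "p 0 = v" "p 1 = a" "\<And>j. p j \<in> U"
    "\<And>j. nbrs U E (p (Suc j)) = {p j, p (Suc (Suc j))}"
    using nat_walk_exists[OF v, of a] ab by blast
  obtain q :: "nat \<Rightarrow> 'a" where q: "q 0 = v" "q 1 = b" "\<And>j. q j \<in> U"
    "\<And>j. nbrs U E (q (Suc j)) = {q j, q (Suc (Suc j))}"
    using nat_walk_exists[OF v, of b] ab by blast
  define c where "c i = (if i \<ge> 0 then p (nat i) else q (nat (- i)))" for i
  have cp: "c (int n) = p n" and cq: "c (- int n) = q n" for n
    using p q by (auto simp: c_def)
  have "c i \<in> U \<and> nbrs U E (c i) = {c (i - 1), c (i + 1)}" for i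
  proof (cases i)
    case (nonneg n)
    show ?thesis
    proof (cases n)
      case 0
      then show ?thesis using nonneg cp[of 0] cp[of 1] cq[of 1] ab v p q by auto
    next
      case (Suc m)
      then have i: "i = int (Suc m)" "i - 1 = int m" "i + 1 = int (Suc (Suc m))" using nonneg by auto
      show ?thesis using p unfolding i(2,3) unfolding i(1) cp by simp
    qed
  next
    case (neg n)
    then have i: "i = - int (Suc n)" "i - 1 = - int (Suc (Suc n))" "i + 1 = - int n" by auto
    show ?thesis using q unfolding i(2,3) unfolding i(1) cq by (simp add: insert_commute)
  qed
  then have "walk c" by (simp add: walk_def)
  moreover have "c 0 = v" using cp[of 0] p by simp
  ultimately show thesis using that by blast
qed

lemma walk_range_closed:
  assumes c: "walk c" and d: "walk d" and "d 0 \<in> range c"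
  shows "range d \<subseteq> range c"
proof -
  obtain i where "c i = d 0" using assms by auto
  then show ?thesis using walk_same_start[OF walk_shift[OF c, of i] d] by auto
qed

text \<open>Together with \<open>walk_exists\<close>, this makes the ranges of walks a partition of
  \<open>U\<close> into cycles.\<close>

lemma walk_ranges_eq:
  assumes c: "walk c" and d: "walk d" and "c i = d j"
  shows "range c = range d"
proof -
  have shift: "range (\<lambda>m. e (l + m)) = range e" for l and e :: "int \<Rightarrow> 'a"
  proof (intro equalityI subsetI)
    fix x assume "x \<in> range e"
    then obtain m where "x = e m" by blast
    then have "x = e (l + (m - l))" by simp
    then show "x \<in> range (\<lambda>m. e (l + m))" by blast
  qed auto
  have "d (j + 0) \<in> range c" "c (i + 0) \<in> range d"
    using assms(3) rangeI[of c i] rangeI[of d j] by simp_all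
  then show ?thesis
    using walk_range_closed[OF c walk_shift[OF d, of j]]
      walk_range_closed[OF d walk_shift[OF c, of i]] unfolding shift by blast
qed

text \<open>The indicators can be added because \<open>walk_neq2\<close> prevents both from holding
  at once.\<close>

lemma adj_mat_walk:
  assumes c: "walk c" and u: "u \<in> U"
  shows "adj_mat E u (c i) = of_bool (u = c (i - 1)) + of_bool (u = c (i + 1))"
proof -
  have "{u, c i} \<in> E \<longleftrightarrow> u \<in> nbrs U E (c i)" using u by (auto simp: nbrs_def insert_commute)
  then show ?thesis using walk_nbrs[OF c, of i] walk_neq2[OF c, of i] by (auto simp: adj_mat_def)
qed

end

subsection \<open>Chebyshev polynomials of adjacency matrices and orthogonal congruence\<close>

definition mat_mul :: "'a set \<Rightarrow> ('a \<Rightarrow> 'a \<Rightarrow> real) \<Rightarrow> ('a \<Rightarrow> 'a \<Rightarrow> real) \<Rightarrow> 'a \<Rightarrow> 'a \<Rightarrow> real" where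
  "mat_mul U A B u v = (\<Sum>z\<in>U. A u z * B z v)"

definition congr_mat :: "'a set \<Rightarrow> ('a \<Rightarrow> 'a \<Rightarrow> real) \<Rightarrow> ('a \<Rightarrow> 'a \<Rightarrow> real) \<Rightarrow> 'a \<Rightarrow> 'a \<Rightarrow> real" where
  "congr_mat U M A u v = (\<Sum>x\<in>U. \<Sum>y\<in>U. M x u * A x y * M y v)"

lemma mat_mul_assoc: "mat_mul U (mat_mul U A B) C = mat_mul U A (mat_mul U B C)"
  unfolding mat_mul_def
  by (intro ext, simp add: sum_distrib_left sum_distrib_right mult.assoc, rule sum.swap)

text \<open>The normalisation is the one with initial value 2, that is T_j(2 cos t) = 2 cos (j t).\<close>
fun cheb :: "'a set \<Rightarrow> ('a \<Rightarrow> 'a \<Rightarrow> real) \<Rightarrow> nat \<Rightarrow> 'a \<Rightarrow> 'a \<Rightarrow> real" where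
  "cheb U A 0 u v = 2 * of_bool (u = v)"
| "cheb U A (Suc 0) u v = A u v"
| "cheb U A (Suc (Suc j)) u v = mat_mul U A (cheb U A (Suc j)) u v - cheb U A j u v"

text \<open>Along \<open>c\<close> the adjacency matrix acts as the sum of the shift z by one and
  its inverse, so the recurrence yields z^j + z^(-j). If the two positions coincide, the entry is
  2.\<close>

lemma (in two_regular) cheb_walk:
  assumes c: "walk c" and u: "u \<in> U"
  shows "cheb U (adj_mat E) j u (c 0) = of_bool (u = c (int j)) + of_bool (u = c (- int j))"
  using u
proof (induction j arbitrary: u rule: induct_nat_012)
  case 0
  then show ?case by simp
next
  case 1
  then show ?case using adj_mat_walk[OF c, of u 0] by simp
next
  case (ge2 j)
  have "mat_mul U (adj_mat E) (cheb U (adj_mat E) (Suc j)) u (c 0)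
      = (\<Sum>z\<in>U. adj_mat E u z * (of_bool (z = c (int (Suc j))) + of_bool (z = c (- int (Suc j)))))"
    using ge2 by (simp add: mat_mul_def)
  also have "\<dots> = adj_mat E u (c (int (Suc j))) + adj_mat E u (c (- int (Suc j)))"
    by (simp only: distrib_left sum.distrib sum_of_bool_eq(1)[OF fin walk_in[OF c]])
  finally show ?case
    using ge2 by (simp add: adj_mat_walk[OF c] algebra_simps)
qed

locale orth_congr =
  fixes U :: "'a set" and M A B :: "'a \<Rightarrow> 'a \<Rightarrow> real"
  assumes fin: "finite U"
    and cols: "u \<in> U \<Longrightarrow> v \<in> U \<Longrightarrow> (\<Sum>x\<in>U. M x u * M x v) = of_bool (u = v)"
    and congr: "u \<in> U \<Longrightarrow> v \<in> U \<Longrightarrow> B u v = congr_mat U M A u v"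
begin

text \<open>Bessel's inequality bounds every diagonal entry of the Gram matrix of the rows by one, and
  its trace is the number of columns.\<close>
lemma rows:
  assumes x: "x \<in> U" and y: "y \<in> U"
  shows "(\<Sum>u\<in>U. M x u * M y u) = of_bool (x = y)"
proof -
  define p where "p x y = (\<Sum>u\<in>U. M x u * M y u)" for x y
  \<comment> \<open>\<open>p\<close> is a symmetric idempotent, hence so is its difference from the
    identity, and the squared norm of a row of that difference is its diagonal entry.\<close>
  have defect: "(\<Sum>y\<in>U. (of_bool (x = y) - p x y)\<^sup>2) = 1 - p x x" if x: "x \<in> U" for x
  proof -
    have "(\<Sum>y\<in>U. (p x y)\<^sup>2) = (\<Sum>y\<in>U. \<Sum>u\<in>U. \<Sum>v\<in>U. M x u * M x v * (M y u * M y v))"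
      by (simp add: p_def power2_eq_square sum_product mult_ac)
    also have "\<dots> = (\<Sum>u\<in>U. \<Sum>v\<in>U. \<Sum>y\<in>U. M x u * M x v * (M y u * M y v))"
      by (subst sum.swap) (intro sum.cong refl sum.swap)
    also have "\<dots> = (\<Sum>u\<in>U. \<Sum>v\<in>U. M x u * M x v * of_bool (u = v))"
      by (intro sum.cong refl) (simp add: sum_distrib_left[symmetric] cols)
    also have "\<dots> = p x x"
      unfolding p_def by (intro sum.cong refl) (rule sum_of_bool_eq(2)[OF fin])
    finally have "(\<Sum>y\<in>U. (p x y)\<^sup>2) = p x x" .
    moreover have "(\<Sum>y\<in>U. (of_bool (x = y) - p x y)\<^sup>2)
        = (\<Sum>y\<in>U. of_bool (x = y) * (1 - 2 * p x y) + (p x y)\<^sup>2)"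
      by (intro sum.cong refl) (auto simp: power2_eq_square algebra_simps)
    ultimately show ?thesis
      by (simp only: sum.distrib sum_of_bool_eq(3)[OF fin x])
  qed
  have "(\<Sum>x\<in>U. p x x) = (\<Sum>u\<in>U. \<Sum>x\<in>U. M x u * M x u)"
    unfolding p_def by (rule sum.swap)
  also have "\<dots> = card U" by (simp add: cols)
  finally have "(\<Sum>x\<in>U. 1 - p x x) = 0" by (simp add: sum_subtractf)
  moreover have "0 \<le> 1 - p x x" if "x \<in> U" for x
    using defect[OF that] sum_nonneg[of U "\<lambda>y. (of_bool (x = y) - p x y)\<^sup>2"] by simp
  ultimately have "1 - p x x = 0"
    using x fin by (subst (asm) sum_nonneg_eq_0_iff) auto
  then have "(\<Sum>y\<in>U. (of_bool (x = y) - p x y)\<^sup>2) = 0" using defect[OF x] by simp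
  then have "(of_bool (x = y) - p x y)\<^sup>2 = 0"
    using y fin by (subst (asm) sum_nonneg_eq_0_iff) auto
  then show ?thesis by (simp add: p_def)
qed

text \<open>The inner product of \<open>M\<close> with its transpose cancels by
  \<open>rows\<close>.\<close>

lemma congr_mul:
  assumes u: "u \<in> U" and v: "v \<in> U"
  shows "mat_mul U (congr_mat U M C) (congr_mat U M D) u v = congr_mat U M (mat_mul U C D) u v"
proof -
  define Mt where "Mt u x = M x u" for u x
  \<comment> \<open>Associativity holds for all indices, but \<open>M\<close> times its transpose
    acts as the identity only on rows in \<open>U\<close>; fact \<open>2\<close> confines the
    rewriting to those.\<close>
  have 1: "mat_mul U (mat_mul U M Mt) X x y = X x y" if "x \<in> U" for X x y
    using rows[OF that] that sum_of_bool_eq(3)[OF fin that] by (simp add: mat_mul_def Mt_def cong: sum.cong)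
  have 2: "mat_mul U K X x y = mat_mul U K Y x y" if "\<And>z. z \<in> U \<Longrightarrow> X z y = Y z y" for K X Y x y
    using that by (simp add: mat_mul_def)
  have c: "congr_mat U M K = mat_mul U Mt (mat_mul U K M)" for K
    by (intro ext) (simp add: congr_mat_def mat_mul_def Mt_def sum_distrib_left mult_ac)
  show ?thesis
    unfolding c mat_mul_assoc by (intro 2) (simp only: mat_mul_assoc[of U M Mt, symmetric] 1)
qed

lemma congr_trace: "(\<Sum>u\<in>U. congr_mat U M C u u) = (\<Sum>u\<in>U. C u u)"
proof -
  have "(\<Sum>u\<in>U. congr_mat U M C u u) = (\<Sum>x\<in>U. \<Sum>y\<in>U. \<Sum>u\<in>U. M x u * C x y * M y u)"
    unfolding congr_mat_def by (subst sum.swap) (intro sum.cong refl sum.swap)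
  also have "\<dots> = (\<Sum>x\<in>U. \<Sum>y\<in>U. C x y * of_bool (x = y))"
    by (intro sum.cong refl) (simp add: rows[symmetric] sum_distrib_left mult_ac)
  also have "\<dots> = (\<Sum>x\<in>U. C x x)"
    by (intro sum.cong refl) (rule sum_of_bool_eq(2)[OF fin])
  finally show ?thesis .
qed

lemma mul_congr:
  assumes "u \<in> U" "v \<in> U" and D': "\<And>u v. u \<in> U \<Longrightarrow> v \<in> U \<Longrightarrow> D' u v = congr_mat U M D u v"
  shows "mat_mul U B D' u v = congr_mat U M (mat_mul U A D) u v"
proof -
  have "mat_mul U B D' u v = mat_mul U (congr_mat U M A) (congr_mat U M D) u v"
    unfolding mat_mul_def using assms congr by (intro sum.cong refl) simp
  then show ?thesis using congr_mul assms by simp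
qed

text \<open>Congruence fixes the identity by \<open>cols\<close> and respects sums and products,
  hence every polynomial in the matrix.\<close>

lemma congr_cheb:
  assumes "u \<in> U" "v \<in> U"
  shows "cheb U B j u v = congr_mat U M (cheb U A j) u v"
  using assms
proof (induction j arbitrary: u v rule: induct_nat_012)
  case 0
  have "congr_mat U M (\<lambda>u v. 2 * of_bool (u = v)) u v = (\<Sum>x\<in>U. \<Sum>y\<in>U. (2 * M x u * M y v) * of_bool (x = y))"
    unfolding congr_mat_def by (simp add: mult_ac)
  also have "\<dots> = (\<Sum>x\<in>U. 2 * M x u * M x v)"
    by (intro sum.cong refl) (rule sum_of_bool_eq(2)[OF fin])
  also have "\<dots> = 2 * of_bool (u = v)"
    using 0 by (simp add: cols[symmetric] sum_distrib_left mult_ac)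
  finally show ?case unfolding cheb.simps by (rule sym)
next
  case 1
  then show ?case using congr by (simp add: congr_mat_def)
next
  case (ge2 j)
  have "cheb U B (Suc (Suc j)) u v = congr_mat U M (mat_mul U A (cheb U A (Suc j))) u v - congr_mat U M (cheb U A j) u v"
    using mul_congr[OF ge2.prems ge2.IH(2)] ge2.IH(1)[OF ge2.prems] by simp
  then show ?case
    by (simp add: congr_mat_def sum_subtractf[symmetric] algebra_simps)
qed

lemma cheb_trace: "(\<Sum>u\<in>U. cheb U B j u u) = (\<Sum>u\<in>U. cheb U A j u u)"
  using congr_trace congr_cheb by simp

text \<open>Meant for vertices outside the switching set, whose columns in the switching matrix are
  unit vectors up to sign.\<close>

lemma congr_entry:
  assumes w: "w \<in> U" "w' \<in> U" and Mw: "\<And>x. x \<in> U \<Longrightarrow> M x w = s * of_bool (x = w)"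
    and Mw': "\<And>x. x \<in> U \<Longrightarrow> M x w' = s' * of_bool (x = w')"
  shows "congr_mat U M C w w' = s * s' * C w w'"
proof -
  have "congr_mat U M C w w' = (\<Sum>x\<in>U. \<Sum>y\<in>U. (s * s' * C x y * of_bool (x = w)) * of_bool (y = w'))"
    unfolding congr_mat_def using Mw Mw' by (intro sum.cong refl) simp
  also have "\<dots> = s * s' * C w w'"
    by (simp only: sum_of_bool_eq(1)[OF fin] w)
  finally show ?thesis .
qed

end


subsection \<open>Isomorphisms between unions of cycles\<close>

text \<open>Finiteness turns an injective self-map into a bijection; matching neighbourhoods are
  what walks supply directly.\<close>

lemma graph_iso_of_nbrs:
  assumes fin: "finite U" and inj: "inj_on f U" and fU: "f ` U \<subseteq> U"
    and nb: "\<And>u. u \<in> U \<Longrightarrow> f ` nbrs U E u = nbrs U F (f u)"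
  shows "bij_betw f U U" and "\<forall>u\<in>U. \<forall>v\<in>U. {u, v} \<in> E \<longleftrightarrow> {f u, f v} \<in> F"
proof -
  show "bij_betw f U U"
    using fin inj fU by (simp add: bij_betw_def endo_inj_surj)
  show "\<forall>u\<in>U. \<forall>v\<in>U. {u, v} \<in> E \<longleftrightarrow> {f u, f v} \<in> F"
  proof (intro ballI)
    fix u v assume u: "u \<in> U" and v: "v \<in> U"
    have "{u, v} \<in> E \<longleftrightarrow> v \<in> nbrs U E u" using v by (simp add: nbrs_def)
    also have "\<dots> \<longleftrightarrow> f v \<in> f ` nbrs U E u"
      using inj v by (subst inj_on_image_mem_iff[of f U]) (auto simp: nbrs_def)
    also have "\<dots> \<longleftrightarrow> {f u, f v} \<in> F"
      unfolding nb[OF u] using fU v by (auto simp: nbrs_def)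
    finally show "{u, v} \<in> E \<longleftrightarrow> {f u, f v} \<in> F" .
  qed
qed

locale two_regular_pair = G: two_regular U E + H: two_regular U F
  for U :: "'a set" and E F :: "'a set set"
begin

text \<open>A positive trace of T_j detects a return after j steps. So every period of
  \<open>d\<close> is a period of \<open>c\<close>, and since \<open>c\<close> visits all of
  \<open>U\<close>, counting vertices gives the converse.\<close>

lemma iso_of_equal_traces:
  assumes c: "G.walk c" and range: "range c = U"
    and trace: "\<And>j. (\<Sum>v\<in>U. cheb U (adj_mat E) j v v) = (\<Sum>v\<in>U. cheb U (adj_mat F) j v v)"
  obtains f where "bij_betw f U U" "\<forall>u\<in>U. \<forall>v\<in>U. {u, v} \<in> E \<longleftrightarrow> {f u, f v} \<in> F"
proof -
  obtain d where d: "H.walk d" "d 0 = c 0"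
    using H.walk_exists[OF G.walk_in[OF c, of 0]] by blast
  have cheb_G: "cheb U (adj_mat E) j (c l) (c l) = of_bool (c l = c (l + int j)) + of_bool (c l = c (l - int j))" for j l
    using G.cheb_walk[OF G.walk_shift[OF c, of l] G.walk_in[OF c], of j l] by simp
  \<comment> \<open>Without negative entries nothing cancels in the trace, so a single return in
    \<open>F\<close> makes it positive.\<close>
  have cheb_H: "cheb U (adj_mat F) j v v \<ge> 0" if v: "v \<in> U" for j v
  proof -
    obtain e where "H.walk e" "e 0 = v" using H.walk_exists[OF v] by blast
    then show ?thesis using H.cheb_walk[of e v j] v by simp
  qed
  have nat_period: "c (int m) = c 0" if "d (int m) = d 0" for m
  proof -
    have "0 < cheb U (adj_mat F) m (d 0) (d 0)"
      using H.cheb_walk[OF d(1) H.walk_in[OF d(1), of 0], of m] that by simp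
    then have "0 < (\<Sum>v\<in>U. cheb U (adj_mat F) m v v)"
      using cheb_H by (intro sum_pos2[OF G.fin H.walk_in[OF d(1), of 0]]) auto
    then have "\<not> (\<forall>v\<in>U. cheb U (adj_mat E) m v v = 0)"
      unfolding trace[symmetric] using sum.neutral[of U] by fastforce
    then obtain l where "cheb U (adj_mat E) m (c l) (c l) \<noteq> 0" using range by blast
    then have "c l = c (l + int m) \<or> c l = c (l - int m)" using cheb_G[of m l] by auto
    then show ?thesis
      using G.walk_eq_0_iff[OF c, of "l + int m" l] G.walk_eq_0_iff[OF c, of l "l - int m"] by auto
  qed
  have period: "c i = c j" if "d i = d j" for i j
  proof -
    have *: "d (i - j) = d 0" "d (j - i) = d 0"
      using H.walk_eq_0_iff[OF d(1), of i j] H.walk_eq_0_iff[OF d(1), of j i] that by auto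
    show ?thesis
    proof (cases "i \<ge> j")
      case True
      then have "c (i - j) = c 0" using nat_period[of "nat (i - j)"] * by simp
      then show ?thesis using G.walk_eq_0_iff[OF c] by simp
    next
      case False
      then have "c (j - i) = c 0" using nat_period[of "nat (j - i)"] * by simp
      then show ?thesis using G.walk_eq_0_iff[OF c, of j i] by simp
    qed
  qed
  define g where "g v = c (SOME i. d i = v)" for v
  have g: "g (d i) = c i" for i
    unfolding g_def by (rule period) (rule someI[of "\<lambda>j. d j = d i", OF refl])
  \<comment> \<open>\<open>g\<close> maps a subset of the finite set \<open>U\<close> onto
    \<open>U\<close>, so it is injective; this turns the implication \<open>period\<close> into an
    equivalence.\<close>
  have "g ` range d = U" using g range by (auto simp: image_image)
  moreover have "range d \<subseteq> U" using H.walk_in[OF d(1)] by auto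
  ultimately have "inj_on g (range d)"
    by (metis G.fin card_image_le card_mono eq_card_imp_inj_on finite_subset le_antisym)
  then have period': "d i = d j" if "c i = c j" for i j
    using that g by (metis inj_onD rangeI)
  define f where "f v = d (SOME i. c i = v)" for v
  have f: "f (c i) = d i" for i
    unfolding f_def by (rule period') (rule someI[of "\<lambda>j. c j = c i", OF refl])
  have "inj_on f U" unfolding range[symmetric] by (intro inj_onI) (auto simp: f intro: period)
  moreover have "f ` U \<subseteq> U" unfolding range[symmetric] using H.walk_in[OF d(1)] range by (auto simp: f)
  moreover have "f ` nbrs U E u = nbrs U F (f u)" if u: "u \<in> U" for u
  proof -
    obtain i where i: "u = c i" using range u by blast
    show ?thesis unfolding i by (simp add: f G.walk_nbrs[OF c] H.walk_nbrs[OF d(1)])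
  qed
  ultimately show thesis using graph_iso_of_nbrs[OF G.fin, of f E F] that[of f] by simp
qed

end

text \<open>T_j adds the positions \<open>j\<close> and \<open>- j\<close>, so comparing its entries
  can yield only the unordered condition \<open>meet\<close>; the orientation has to be
  recovered.\<close>

locale anchored_pair = two_regular_pair U E F
  for U :: "'a set" and E F :: "'a set set" +
  fixes W :: "'a set"
  assumes W_sub: "W \<subseteq> U"
    and meet: "\<And>c d w j. G.walk c \<Longrightarrow> H.walk d \<Longrightarrow> c 0 = d 0 \<Longrightarrow> c 0 \<in> W \<Longrightarrow> w \<in> W \<Longrightarrow>
      c j = w \<or> c (- j) = w \<longleftrightarrow> d j = w \<or> d (- j) = w"
begin

text \<open>With \<open>w\<close> the start, the two alternatives of \<open>meet\<close> coincide,
  since returning after n steps and after -n steps are equivalent.\<close>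

lemma periods_agree:
  assumes c: "G.walk c" and d: "H.walk d" and 0: "c 0 = d 0" "c 0 \<in> W"
  shows "c i = c j \<longleftrightarrow> d i = d j"
proof -
  have "c (i - j) = c 0 \<or> c (- (i - j)) = c 0 \<longleftrightarrow> d (i - j) = d 0 \<or> d (- (i - j)) = d 0"
    using meet[OF c d 0 0(2), of "i - j"] by (simp only: 0(1))
  then show ?thesis
    by (simp only: G.walk_eq_0_iff[OF c, of i j] H.walk_eq_0_iff[OF d, of i j]
        G.walk_uminus_eq_0_iff[OF c] H.walk_uminus_eq_0_iff[OF d] simp_thms)
qed

text \<open>Cyclic distances between the points of W agree, and a reflection that is forced by one point
  is the right one for all the others.\<close>
lemma aligned_walk:
  assumes c: "G.walk c" and 0: "c 0 \<in> W"
  obtains d where "H.walk d" "d 0 = c 0" "\<And>i. c i \<in> W \<Longrightarrow> d i = c i"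
proof -
  obtain d where d: "H.walk d" "d 0 = c 0" using H.walk_exists 0 W_sub by blast
  show thesis
  proof (cases "\<forall>i. c i \<in> W \<longrightarrow> d i = c i")
    case True
    then show thesis using that d by blast
  next
    case False
    then obtain j where j: "c j \<in> W" "d j \<noteq> c j" by blast
    then have dj: "d (- j) = c j" using meet[OF c d(1) d(2)[symmetric] 0 j(1), of j] by auto
    have "d (0 - i) = c i" if i: "c i \<in> W" for i
    proof (rule ccontr)
      assume neq: "d (0 - i) \<noteq> c i"
      then have di: "d i = c i" using meet[OF c d(1) d(2)[symmetric] 0 i, of i] by auto
      \<comment> \<open>\<open>meet\<close> is used from the base vertex
        \<open>c j = d (- j)\<close>. Its second alternative is \<open>d (- i) = c i\<close>,
        excluded by \<open>neq\<close>; the first gives the period \<open>2 * j\<close>, so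
        \<open>d j = d (- j) = c j\<close>, against the choice of \<open>j\<close>.\<close>
      have "d (- j + (i - j)) = c i \<or> d (- j + - (i - j)) = c i"
        using meet[OF G.walk_shift[OF c, of j] H.walk_shift[OF d(1), of "- j"] _ _ i, of "i - j"] j dj by simp
      then have "d (i - 2 * j) = d i" using neq di by (simp add: algebra_simps)
      from H.walk_period[OF d(1) this, of "j - i"] have "d (- j) = d j" by (simp add: algebra_simps)
      then show False using j dj by simp
    qed
    then show thesis using that[OF H.walk_reverse[OF d(1), of 0]] d(2) by simp
  qed
qed

text \<open>Each cycle of \<open>E\<close> gets an anchor in \<open>W\<close>, and its walk from the
  anchor is sent to the aligned walk of \<open>F\<close>. \<open>periods_agree\<close> makes this
  well defined and injective on each cycle.\<close>

lemma anchored_iso: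
  assumes hit: "\<And>c. G.walk c \<Longrightarrow> range c \<inter> W \<noteq> {}"
  obtains f where "bij_betw f U U" "\<forall>u\<in>U. \<forall>v\<in>U. {u, v} \<in> E \<longleftrightarrow> {f u, f v} \<in> F"
    "\<And>w. w \<in> W \<Longrightarrow> f w = w"
proof -
  have "\<exists>cw. \<forall>v\<in>U. G.walk (cw v) \<and> cw v 0 = v" using G.walk_exists by (intro bchoice) metis
  then obtain cw where cw: "\<And>v. v \<in> U \<Longrightarrow> G.walk (cw v)" "\<And>v. v \<in> U \<Longrightarrow> cw v 0 = v" by blast
  have "\<exists>dw. \<forall>w\<in>W. H.walk (dw w) \<and> dw w 0 = w \<and> (\<forall>i. cw w i \<in> W \<longrightarrow> dw w i = cw w i)"
    using aligned_walk cw W_sub by (intro bchoice) (metis subsetD)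
  then obtain dw where dw: "\<And>w. w \<in> W \<Longrightarrow> H.walk (dw w)" "\<And>w. w \<in> W \<Longrightarrow> dw w 0 = w"
    "\<And>w i. w \<in> W \<Longrightarrow> cw w i \<in> W \<Longrightarrow> dw w i = cw w i" by blast
  \<comment> \<open>The choice depends on \<open>v\<close> only through its cycle, so all vertices
    of a cycle share one anchor.\<close>
  define r where "r v = (SOME w. w \<in> W \<inter> range (cw v))" for v
  have r: "r v \<in> W" "r v \<in> range (cw v)" if "v \<in> U" for v
    using someI_ex[of "\<lambda>w. w \<in> W \<inter> range (cw v)"] hit[OF cw(1)[OF that]] unfolding r_def by blast+
  have rU: "r v \<in> U" if "v \<in> U" for v using r W_sub that by blast
  have rng: "range (cw (r v)) = range (cw v)" if v: "v \<in> U" for v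
  proof -
    obtain i where "cw v i = r v" using r(2)[OF v] by auto
    then show ?thesis using G.walk_ranges_eq[OF cw(1)[OF rU[OF v]] cw(1)[OF v], of 0 i] cw(2)[OF rU[OF v]] by simp
  qed
  have r_eq: "r u = r v" if uv: "u \<in> U" "v \<in> U" and eq: "cw (r u) i = cw (r v) j" for u v i j
  proof -
    have "range (cw (r u)) = range (cw (r v))"
      using G.walk_ranges_eq[OF cw(1)[OF rU[OF uv(1)]] cw(1)[OF rU[OF uv(2)]] eq] .
    then show ?thesis using uv rng by (simp add: r_def)
  qed
  define ix where "ix v = (SOME i. cw (r v) i = v)" for v
  have ix: "cw (r v) (ix v) = v" if v: "v \<in> U" for v
  proof -
    have "v \<in> range (cw (r v))" unfolding rng[OF v] using cw(2)[OF v] by (metis rangeI)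
    then obtain i where "cw (r v) i = v" by (metis imageE)
    then show ?thesis unfolding ix_def by (rule someI)
  qed
  define f where "f v = dw (r v) (ix v)" for v
  have per: "cw (r v) i = cw (r v) j \<longleftrightarrow> dw (r v) i = dw (r v) j" if "v \<in> U" for v i j
    using periods_agree cw dw r(1) rU that by simp
  have f: "f (cw (r v) i) = dw (r v) i" if v: "v \<in> U" for v i
  proof -
    let ?u = "cw (r v) i"
    have u: "?u \<in> U" using G.walk_in[OF cw(1)[OF rU[OF v]]] .
    have "r ?u = r v" using r_eq[OF u v ix[OF u]] .
    then show ?thesis using ix[OF u] per[OF v] by (simp add: f_def)
  qed
  have "inj_on f U"
  proof (rule inj_onI)
    fix u v assume uv: "u \<in> U" "v \<in> U" and eq: "f u = f v"
    have "range (dw (r u)) = range (dw (r v))"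
      using eq H.walk_ranges_eq[OF dw(1)[OF r(1)[OF uv(1)]] dw(1)[OF r(1)[OF uv(2)]]] by (simp add: f_def)
    \<comment> \<open>If the images lie on one cycle of \<open>F\<close>, the anchors are
      \<open>m\<close> steps apart there, so by \<open>meet\<close> they lie on one cycle of
      \<open>E\<close>.\<close>
    then obtain m where m: "dw (r u) m = r v" using dw(2)[OF r(1)[OF uv(2)]] by (metis rangeE rangeI)
    have "cw (r u) m = r v \<or> cw (r u) (- m) = r v"
      using meet[OF cw(1)[OF rU[OF uv(1)]] dw(1)[OF r(1)[OF uv(1)]] _ _ r(1)[OF uv(2)], of m] m
        cw(2)[OF rU[OF uv(1)]] dw(2)[OF r(1)[OF uv(1)]] r(1)[OF uv(1)] by simp
    then have "r u = r v" using r_eq[OF uv] cw(2)[OF rU[OF uv(2)]] by metis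
    then show "u = v" using eq per[OF uv(1)] ix uv by (metis f_def)
  qed
  moreover have "f ` U \<subseteq> U" using H.walk_in dw(1) r(1) by (auto simp: f_def)
  moreover have "f ` nbrs U E u = nbrs U F (f u)" if u: "u \<in> U" for u
    using G.walk_nbrs[OF cw(1)[OF rU[OF u]], of "ix u"] H.walk_nbrs[OF dw(1)[OF r(1)[OF u]], of "ix u"]
      ix[OF u] f[OF u] by (simp add: f_def)
  moreover have "f w = w" if w: "w \<in> W" for w
  proof -
    have "w \<in> U" using w W_sub by blast
    then show ?thesis using dw(3)[OF r(1), of w "ix w"] ix[of w] w by (simp add: f_def)
  qed
  ultimately show thesis using graph_iso_of_nbrs[OF G.fin, of f E F] that[of f] by simp
qed

end

subsection \<open>Congruence preserves 2-regularity\<close>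

lemma sum_adj_mat:
  assumes "finite U"
  shows "(\<Sum>v\<in>U. adj_mat E u v) = card (nbrs U E u)"
  using assms by (simp add: adj_mat_def nbrs_def sum.If_cases Int_def)

lemma adj_mat_sym: "adj_mat E u v = adj_mat E v u"
  by (simp add: adj_mat_def insert_commute)

lemma adj_mat_sq_diag:
  assumes "finite U"
  shows "mat_mul U (adj_mat E) (adj_mat E) u u = card (nbrs U E u)"
proof -
  have "mat_mul U (adj_mat E) (adj_mat E) u u = (\<Sum>z\<in>U. adj_mat E u z)"
    unfolding mat_mul_def by (intro sum.cong refl) (simp add: adj_mat_def insert_commute)
  then show ?thesis using sum_adj_mat[OF assms] by simp
qed

text \<open>Parseval's identity. The index order of \<open>N\<close> lets it serve for the rows of a
  matrix and, after transposing, for its columns.\<close>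

lemma sum_orthonormal_combination_sq:
  assumes fin: "finite U"
    and orth: "\<And>i j. i \<in> U \<Longrightarrow> j \<in> U \<Longrightarrow> (\<Sum>z\<in>U. N i z * N j z) = of_bool (i = j)"
  shows "(\<Sum>z\<in>U. (\<Sum>i\<in>U. N i z * g i)\<^sup>2) = (\<Sum>i\<in>U. (g i :: real)\<^sup>2)"
proof -
  have "(\<Sum>z\<in>U. (\<Sum>i\<in>U. N i z * g i)\<^sup>2) = (\<Sum>z\<in>U. \<Sum>i\<in>U. \<Sum>j\<in>U. g i * g j * (N i z * N j z))"
    by (simp add: power2_eq_square sum_product mult_ac)
  also have "\<dots> = (\<Sum>i\<in>U. \<Sum>j\<in>U. \<Sum>z\<in>U. g i * g j * (N i z * N j z))"
    by (subst sum.swap) (intro sum.cong refl sum.swap)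
  also have "\<dots> = (\<Sum>i\<in>U. \<Sum>j\<in>U. g i * g j * of_bool (i = j))"
    by (intro sum.cong refl) (simp add: sum_distrib_left[symmetric] orth)
  also have "\<dots> = (\<Sum>i\<in>U. g i * g i)"
    by (intro sum.cong refl) (rule sum_of_bool_eq(2)[OF fin])
  finally show ?thesis by (simp add: power2_eq_square)
qed

text \<open>The spectral norm is at most 2: \<open>(a + b)\<^sup>2\<close> is at most twice the sum
  of the squares, and each vertex is counted once for each of its two neighbours.\<close>

lemma (in two_regular) sum_adj_sq_le:
  "(\<Sum>x\<in>U. (\<Sum>y\<in>U. adj_mat E x y * g y)\<^sup>2) \<le> 4 * (\<Sum>y\<in>U. (g y)\<^sup>2)"
proof -
  have adj_sum: "(\<Sum>y\<in>U. adj_mat E x y * h y) = sum h (nbrs U E x)" for x h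
  proof -
    have "(\<Sum>y\<in>U. adj_mat E x y * h y) = (\<Sum>y\<in>U. if {x, y} \<in> E then h y else 0)"
      by (intro sum.cong refl) (simp add: adj_mat_def)
    then show ?thesis using sum.inter_filter[OF fin, of h "\<lambda>y. {x, y} \<in> E"] by (simp add: nbrs_def)
  qed
  have "(\<Sum>y\<in>U. adj_mat E x y * g y)\<^sup>2 \<le> 2 * (\<Sum>y\<in>U. adj_mat E x y * (g y)\<^sup>2)" if x: "x \<in> U" for x
  proof -
    obtain a b where "nbrs U E x = {a, b}" "a \<noteq> b" using card_nbrs[OF x] by (auto simp: card_2_iff)
    then show ?thesis
      using sum_squares_ge_zero[of "g a - g b" 0]
      unfolding adj_sum by (simp add: power2_eq_square algebra_simps)
  qed
  then have "(\<Sum>x\<in>U. (\<Sum>y\<in>U. adj_mat E x y * g y)\<^sup>2) \<le> (\<Sum>x\<in>U. 2 * (\<Sum>y\<in>U. adj_mat E x y * (g y)\<^sup>2))"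
    by (rule sum_mono)
  also have "\<dots> = 2 * (\<Sum>y\<in>U. \<Sum>x\<in>U. adj_mat E x y * (g y)\<^sup>2)"
    by (simp add: sum_distrib_left[symmetric]) (rule sum.swap)
  also have "\<dots> = 2 * (\<Sum>y\<in>U. 2 * (g y)\<^sup>2)"
    using sum_adj_mat[OF fin, of E] card_nbrs
    by (simp add: sum_distrib_right[symmetric] adj_mat_sym[of E _ y for y])
  finally show ?thesis by (simp add: sum_distrib_left[symmetric])
qed

text \<open>The congruence preserves the number of edges and the bound 2 on the spectral norm, and only
  regular graphs attain equality between average degree and spectral norm.\<close>
lemma two_regular_congr:
  assumes G: "two_regular U E" and oc: "orth_congr U M (adj_mat E) (adj_mat F)"
    and loopfree: "\<And>u. u \<in> U \<Longrightarrow> {u} \<notin> F"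
  shows "two_regular U F"
proof -
  interpret G: two_regular U E by fact
  interpret oc: orth_congr U M "adj_mat E" "adj_mat F" by fact
  note fin = G.fin
  define deg where "deg u = real (card (nbrs U F u))" for u
  \<comment> \<open>The diagonal of a squared adjacency matrix lists the degrees, so invariance of
    the trace preserves the degree sum.\<close>
  have "(\<Sum>u\<in>U. mat_mul U (adj_mat F) (adj_mat F) u u) = (\<Sum>u\<in>U. mat_mul U (adj_mat E) (adj_mat E) u u)"
    using oc.congr_trace[of "mat_mul U (adj_mat E) (adj_mat E)"] oc.mul_congr[OF _ _ oc.congr] by simp
  then have sum_deg: "(\<Sum>u\<in>U. deg u) = 2 * card U"
    by (simp add: adj_mat_sq_diag[OF fin] deg_def G.card_nbrs)
  \<comment> \<open>\<open>h\<close> is \<open>M\<close> applied to the all-ones vector, and the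
    degrees in \<open>F\<close> are the transpose of \<open>M\<close> applied to \<open>g\<close>.
    The factor 1 gives \<open>h\<close> the shape used in Parseval's identity.\<close>
  define h where "h x = (\<Sum>u\<in>U. M x u * 1)" for x
  define g where "g x = (\<Sum>y\<in>U. adj_mat E x y * h y)" for x
  have deg_g: "deg u = (\<Sum>x\<in>U. M x u * g x)" if u: "u \<in> U" for u
  proof -
    have "deg u = (\<Sum>v\<in>U. \<Sum>x\<in>U. \<Sum>y\<in>U. M x u * adj_mat E x y * M y v)"
      using oc.congr[OF u] by (simp add: deg_def sum_adj_mat[OF fin, symmetric] congr_mat_def)
    also have "\<dots> = (\<Sum>x\<in>U. \<Sum>y\<in>U. \<Sum>v\<in>U. M x u * adj_mat E x y * M y v)"
      by (subst sum.swap) (intro sum.cong refl sum.swap)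
    finally show ?thesis by (simp add: g_def h_def sum_distrib_left mult_ac)
  qed
  have "(\<Sum>u\<in>U. (deg u)\<^sup>2) = (\<Sum>x\<in>U. (g x)\<^sup>2)"
    using sum_orthonormal_combination_sq[OF fin oc.rows, of g] by (simp add: deg_g)
  also have "\<dots> \<le> 4 * (\<Sum>x\<in>U. (h x)\<^sup>2)"
    unfolding g_def by (rule G.sum_adj_sq_le)
  also have "(\<Sum>x\<in>U. (h x)\<^sup>2) = card U"
    unfolding h_def
    using sum_orthonormal_combination_sq[OF fin, of "\<lambda>u x. M x u" "\<lambda>_. 1"] oc.cols by simp
  finally have "(\<Sum>u\<in>U. (deg u)\<^sup>2) \<le> 4 * card U" by simp
  \<comment> \<open>With n vertices, the squared deviations from 2 sum to at most 4n - 8n + 4n =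
    0.\<close>
  moreover have "(\<Sum>u\<in>U. (deg u - 2)\<^sup>2) = (\<Sum>u\<in>U. (deg u)\<^sup>2) - 4 * (\<Sum>u\<in>U. deg u) + 4 * card U"
    by (simp add: power2_diff sum.distrib sum_subtractf sum_distrib_right sum_distrib_left mult_ac)
  ultimately have "(\<Sum>u\<in>U. (deg u - 2)\<^sup>2) \<le> 0" using sum_deg by simp
  then have "(\<Sum>u\<in>U. (deg u - 2)\<^sup>2) = 0" by (intro antisym sum_nonneg) auto
  then have "deg u = 2" if "u \<in> U" for u
    using that fin by (subst (asm) sum_nonneg_eq_0_iff) auto
  then show ?thesis using fin loopfree by unfold_locales (auto simp: deg_def)
qed


subsection \<open>Sparse graphs\<close>

lemma simple_graph_edge:
  "simple_graph V E \<Longrightarrow> e \<in> E \<Longrightarrow> \<exists>a b. a \<in> V \<and> b \<in> V \<and> a \<noteq> b \<and> e = {a, b}"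
  unfolding simple_graph_def by blast

text \<open>Splitting off the component of a vertex loses no edge, so one of the two sides still has
  more edges than vertices.\<close>

lemma dense_connected_subgraph:
  assumes "finite S" and "\<forall>e\<in>F. e \<subseteq> S" and "\<forall>e\<in>F. \<exists>a b. e = {a, b}" and "card S < card F"
  shows "\<exists>S' F'. S' \<subseteq> S \<and> F' \<subseteq> F \<and> (\<forall>e\<in>F'. e \<subseteq> S') \<and> connected_graph S' F' \<and> card S' < card F'"
  using assms
proof (induction "card S" arbitrary: S F rule: less_induct)
  case less
  show ?case
  proof (cases "connected_graph S F")
    case True
    then show ?thesis using less.prems by blast
  next
    case False
    \<comment> \<open>\<open>connected_graph\<close> also fails on the empty vertex set; this is
      ruled out before two unconnected vertices are chosen.\<close>
    have "F \<noteq> {}" using less.prems(4) by auto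
    then have "S \<noteq> {}" using less.prems(2,3) by fastforce
    then obtain u v where uv: "u \<in> S" "v \<in> S" "(u, v) \<notin> (adj_rel F)\<^sup>*"
      using False by (auto simp: connected_graph_def)
    define S1 where "S1 = {x \<in> S. (u, x) \<in> (adj_rel F)\<^sup>*}"
    define S2 where "S2 = S - S1"
    define F1 where "F1 = {e \<in> F. e \<subseteq> S1}"
    define F2 where "F2 = {e \<in> F. e \<subseteq> S2}"
    have sub: "S1 \<subset> S" "S2 \<subset> S" using uv by (auto simp: S1_def S2_def)
    have "e \<in> F1 \<union> F2" if e: "e \<in> F" for e
    proof -
      obtain a b where ab: "e = {a, b}" using less.prems(3) e by blast
      have "(a, b) \<in> adj_rel F" "(b, a) \<in> adj_rel F"
        using e ab by (auto simp: adj_rel_def insert_commute)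
      then have "a \<in> S1 \<longleftrightarrow> b \<in> S1"
        using e ab less.prems(2) by (auto simp: S1_def intro: rtrancl_into_rtrancl)
      then show ?thesis using e ab less.prems(2) by (auto simp: F1_def F2_def S2_def)
    qed
    then have "F = F1 \<union> F2" by (auto simp: F1_def F2_def)
    then have "card F \<le> card F1 + card F2" by (simp add: card_Un_le)
    moreover have "card S = card S1 + card S2"
      using less.prems(1) sub(1) card_mono[of S S1]
      by (simp add: S2_def card_Diff_subset finite_subset[of S1 S] psubset_imp_subset)
    ultimately have "card S1 < card F1 \<or> card S2 < card F2" using less.prems(4) by linarith
    then obtain T K where TK: "T \<subset> S" "K \<subseteq> F" "\<forall>e\<in>K. e \<subseteq> T" "card T < card K"
    proof
      assume "card S1 < card F1"
      then show thesis using sub(1) by (intro that[of S1 F1]) (auto simp: F1_def)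
    next
      assume "card S2 < card F2"
      then show thesis using sub(2) by (intro that[of S2 F2]) (auto simp: F2_def)
    qed
    have "\<exists>S' F'. S' \<subseteq> T \<and> F' \<subseteq> K \<and> (\<forall>e\<in>F'. e \<subseteq> S') \<and> connected_graph S' F' \<and> card S' < card F'"
    proof (rule less.hyps)
      show "card T < card S" using psubset_card_mono[OF less.prems(1) TK(1)] .
      show "finite T" using TK(1) less.prems(1) finite_subset by blast
      show "\<forall>e\<in>K. \<exists>a b. e = {a, b}" using TK(2) less.prems(3) by blast
    qed (use TK in auto)
    then show ?thesis using TK(1,2) by (meson order_trans psubset_imp_subset)
  qed
qed

text \<open>Handshaking, as an inequality because an edge \<open>{a, b}\<close> with
  \<open>a = b\<close> accounts for a single ordered pair.\<close>

lemma sum_card_nbrs_le: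
  assumes fin: "finite U" and pairs: "\<forall>e\<in>E. \<exists>a b. e = {a, b}"
  shows "(\<Sum>u\<in>U. card (nbrs U E u)) \<le> 2 * card {e \<in> E. e \<subseteq> U}"
proof -
  define F where "F = {e \<in> E. e \<subseteq> U}"
  have finF: "finite F" using fin by (auto simp: F_def intro: finite_subset[of _ "Pow U"])
  have ends: "finite {(u, v). {u, v} = e} \<and> card {(u, v). {u, v} = e} \<le> 2" if "e \<in> F" for e
  proof -
    obtain a b where "e = {a, b}" using pairs \<open>e \<in> F\<close> by (auto simp: F_def)
    then have "{(u, v). {u, v} = e} = {(a, b), (b, a)}" by (auto simp: doubleton_eq_iff)
    then show ?thesis using card_insert_le_m1[of 2 "{(b, a)}" "(a, b)"] by simp
  qed
  have "(\<Sum>u\<in>U. card (nbrs U E u)) = card (Sigma U (nbrs U E))"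
    using fin by (subst card_SigmaI) (auto simp: nbrs_def)
  also have "\<dots> \<le> card (\<Union>e\<in>F. {(u, v). {u, v} = e})"
    using finF ends by (intro card_mono) (auto simp: F_def nbrs_def)
  also have "\<dots> \<le> (\<Sum>e\<in>F. card {(u, v). {u, v} = e})"
    using finF by (rule card_UN_le)
  also have "\<dots> \<le> (\<Sum>e\<in>F. 2)" using ends by (intro sum_mono) simp
  finally show ?thesis by (simp add: F_def mult.commute)
qed

lemma two_regular_of_few_edges:
  assumes fin: "finite U" and pairs: "\<forall>e\<in>E. \<exists>a b. a \<noteq> b \<and> e = {a, b}"
    and deg: "\<And>u. u \<in> U \<Longrightarrow> 2 \<le> card (nbrs U E u)" and few: "card {e \<in> E. e \<subseteq> U} \<le> card U"
  shows "two_regular U E"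
proof
  have le: "(\<Sum>u\<in>U. card (nbrs U E u)) \<le> (\<Sum>u\<in>U. 2)"
    using sum_card_nbrs_le[OF fin, of E] pairs few by fastforce
  show "card (nbrs U E u) = 2" if "u \<in> U" for u
  proof (rule ccontr)
    assume "card (nbrs U E u) \<noteq> 2"
    then have "2 < card (nbrs U E u)" using deg[OF that] by simp
    then have "(\<Sum>u\<in>U. 2) < (\<Sum>u\<in>U. card (nbrs U E u))"
      using fin deg that by (intro sum_strict_mono_ex1) auto
    then show False using le by simp
  qed
  show "{u} \<notin> E" for u
    using pairs by (metis doubleton_eq_iff insert_absorb2)
qed fact

text \<open>Only edges between the two sides are counted; disjointness makes each of them determine
  its end in \<open>Y\<close>.\<close>

lemma card_edges_ge_bipartite:
  assumes fin: "finite X" "finite Y" and disj: "X \<inter> Y = {}"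
    and deg: "\<And>y. y \<in> Y \<Longrightarrow> 2 \<le> card (nbrs X E y)"
  shows "2 * card Y \<le> card {e \<in> E. e \<subseteq> X \<union> Y}"
proof -
  have "2 * card Y = (\<Sum>y\<in>Y. 2)" by simp
  also have "\<dots> \<le> (\<Sum>y\<in>Y. card (nbrs X E y))" using deg by (intro sum_mono)
  also have "\<dots> = card (Sigma Y (nbrs X E))"
    using fin by (subst card_SigmaI) (auto simp: nbrs_def)
  also have "\<dots> \<le> card {e \<in> E. e \<subseteq> X \<union> Y}"
  proof (rule card_inj_on_le)
    show "inj_on (\<lambda>(y, x). {y, x}) (Sigma Y (nbrs X E))"
      using disj by (auto simp: inj_on_def nbrs_def doubleton_eq_iff)
    show "(\<lambda>(y, x). {y, x}) ` Sigma Y (nbrs X E) \<subseteq> {e \<in> E. e \<subseteq> X \<union> Y}"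
      by (auto simp: nbrs_def)
    show "finite {e \<in> E. e \<subseteq> X \<union> Y}"
      using fin by (auto intro: finite_subset[of _ "Pow (X \<union> Y)"])
  qed
  finally show ?thesis .
qed

subsection \<open>Switching\<close>

locale switching =
  fixes V X A B :: "'a set" and EG EH :: "'a set set"
    and k :: nat and Q :: "nat \<Rightarrow> nat \<Rightarrow> real" and \<sigma> :: "nat \<Rightarrow> 'a"
  assumes finV: "finite V" and orth: "orthogonal_mat k Q" and no_int: "no_integral_rows k Q"
    and X_sub: "X \<subseteq> V" and card_X: "card X = k" and bij: "bij_betw \<sigma> {..<k} X"
    and AB: "A \<union> B = V - X"
    and switch: "\<And>u w. u \<in> V \<Longrightarrow> w \<in> V \<Longrightarrow>
      adj_mat EH u w = congr_mat V (switch_mat Q X \<sigma> A B) (adj_mat EG) u w"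
begin

abbreviation "M \<equiv> switch_mat Q X \<sigma> A B"

lemma M_block: "(x \<in> X) \<noteq> (u \<in> X) \<Longrightarrow> M x u = 0"
  by (auto simp: switch_mat_def)

lemma M_diag:
  assumes "v \<in> V - X" "x \<noteq> v"
  shows "M x v = 0" and "M v x = 0"
  using assms
  by (auto simp: switch_mat_def)

lemma M_sign: "v \<in> V - X \<Longrightarrow> M v v = 1 \<or> M v v = -1"
  using AB by (auto simp: switch_mat_def)

lemma M_on_X:
  assumes "i < k" "j < k"
  shows "M (\<sigma> i) (\<sigma> j) = Q i j"
  using assms bij by (auto simp: switch_mat_def card_X bij_betw_def)

text \<open>\<open>M\<close> is block diagonal, and diagonal outside \<open>X\<close>, so
  orthonormality survives restriction to any \<open>U\<close> containing \<open>X\<close>.\<close>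

lemma M_cols:
  assumes XU: "X \<subseteq> U" "U \<subseteq> V" and u: "u \<in> U" and v: "v \<in> U"
  shows "(\<Sum>x\<in>U. M x u * M x v) = of_bool (u = v)"
proof -
  have finU: "finite U" using XU finV finite_subset by blast
  consider "u \<in> X" "v \<in> X" | "v \<notin> X" | "u \<notin> X" by blast
  then show ?thesis
  proof cases
    case 1
    obtain i j where ij: "i < k" "j < k" "u = \<sigma> i" "v = \<sigma> j"
      using 1 bij by (auto simp: bij_betw_def)
    have "(\<Sum>x\<in>U. M x u * M x v) = (\<Sum>x\<in>X. M x u * M x v)"
      using finU XU 1 by (intro sum.mono_neutral_right) (auto simp: M_block)
    also have "\<dots> = (\<Sum>l<k. M (\<sigma> l) u * M (\<sigma> l) v)"
      using sum.reindex_bij_betw[OF bij, of "\<lambda>x. M x u * M x v"] by simp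
    also have "\<dots> = (\<Sum>l<k. Q l i * Q l j)"
      using ij by (intro sum.cong refl) (simp add: M_on_X)
    also have "\<dots> = of_bool (i = j)" using orth ij by (simp add: orthogonal_mat_def)
    also have "i = j \<longleftrightarrow> u = v" using ij bij by (auto simp: bij_betw_def inj_on_def)
    finally show ?thesis .
  next
    case 2
    then have vV: "v \<in> V - X" using v XU by blast
    have "(\<Sum>x\<in>U. M x u * M x v) = (\<Sum>x\<in>U. (M x u * M v v) * of_bool (x = v))"
      by (intro sum.cong refl) (auto simp: M_diag[OF vV])
    also have "\<dots> = M v u * M v v" by (rule sum_of_bool_eq(1)[OF finU v])
    also have "\<dots> = of_bool (u = v)"
      using M_sign[OF vV] M_diag(2)[OF vV, of u] by (cases "u = v") auto
    finally show ?thesis .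
  next
    case 3
    then have uV: "u \<in> V - X" using u XU by blast
    have "(\<Sum>x\<in>U. M x u * M x v) = (\<Sum>x\<in>U. (M u u * M x v) * of_bool (x = u))"
      by (intro sum.cong refl) (auto simp: M_diag[OF uV])
    also have "\<dots> = M u u * M u v" by (rule sum_of_bool_eq(1)[OF finU u])
    also have "\<dots> = of_bool (u = v)"
      using M_sign[OF uV] M_diag(2)[OF uV, of v] by (cases "u = v") auto
    finally show ?thesis .
  qed
qed

text \<open>Columns indexed by \<open>U\<close> vanish outside \<open>U\<close>, so the sums over
  \<open>V\<close> shrink to \<open>U\<close>.\<close>

lemma orth_congr_on:
  assumes XU: "X \<subseteq> U" "U \<subseteq> V"
  shows "orth_congr U M (adj_mat EG) (adj_mat EH)"
proof
  show "finite U" using XU finV finite_subset by blast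
  show "(\<Sum>x\<in>U. M x u * M x v) = of_bool (u = v)" if "u \<in> U" "v \<in> U" for u v
    using M_cols[OF XU that] .
  have out: "M x u = 0" if "x \<in> V - U" "u \<in> U" for x u
    using that XU by (auto simp: switch_mat_def)
  show "adj_mat EH u v = congr_mat U M (adj_mat EG) u v" if uv: "u \<in> U" "v \<in> U" for u v
  proof -
    have "congr_mat V M (adj_mat EG) u v = (\<Sum>x\<in>U. \<Sum>y\<in>V. M x u * adj_mat EG x y * M y v)"
      unfolding congr_mat_def using finV XU out uv by (intro sum.mono_neutral_right) auto
    also have "\<dots> = congr_mat U M (adj_mat EG) u v"
      unfolding congr_mat_def using finV XU out uv
      by (intro sum.cong refl sum.mono_neutral_right) auto
    finally show ?thesis using switch[of u v] uv subsetD[OF XU(2)] by simp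
  qed
qed

lemma adj_outside:
  assumes u: "u \<in> V" and v: "v \<in> V - X"
  shows "adj_mat EH u v = (\<Sum>x\<in>V. M x u * adj_mat EG x v) * M v v"
proof -
  have "adj_mat EH u v = (\<Sum>x\<in>V. \<Sum>y\<in>V. (M x u * adj_mat EG x y * M v v) * of_bool (y = v))"
    using switch[OF u, of v] v unfolding congr_mat_def
    by simp (intro sum.cong refl, auto simp: M_diag[OF v])
  also have "\<dots> = (\<Sum>x\<in>V. M x u * adj_mat EG x v * M v v)"
    using v by (intro sum.cong refl sum_of_bool_eq(1)[OF finV]) blast
  finally show ?thesis by (simp add: sum_distrib_right)
qed

text \<open>Both columns of \<open>M\<close> are unit vectors up to sign, so the entries agree up to
  sign, and being 0 or 1 they agree.\<close>

lemma edge_outside_iff: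
  assumes u: "u \<in> V - X" and v: "v \<in> V - X"
  shows "{u, v} \<in> EG \<longleftrightarrow> {u, v} \<in> EH"
proof -
  have "(\<Sum>x\<in>V. M x u * adj_mat EG x v) = (\<Sum>x\<in>V. (M u u * adj_mat EG x v) * of_bool (x = u))"
    by (intro sum.cong refl) (auto simp: M_diag[OF u])
  also have "\<dots> = M u u * adj_mat EG u v"
    using u by (intro sum_of_bool_eq(1)[OF finV]) blast
  finally have "adj_mat EH u v = M u u * adj_mat EG u v * M v v"
    using adj_outside[OF _ v, of u] u by simp
  then show ?thesis using M_sign[OF u] M_sign[OF v] by (auto simp: adj_mat_def split: if_splits)
qed

lemma adj_X_outside:
  assumes u: "u \<in> X" and v: "v \<in> V - X"
  shows "adj_mat EH u v = (\<Sum>x\<in>nbrs X EG v. M x u) * M v v"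
proof -
  have "M x u = 0" if "x \<notin> X" for x using M_block that u by blast
  then have "(\<Sum>x\<in>V. M x u * adj_mat EG x v) = (\<Sum>x\<in>nbrs X EG v. M x u * adj_mat EG x v)"
    using finV X_sub
    by (intro sum.mono_neutral_right) (auto simp: nbrs_def adj_mat_def insert_commute)
  also have "\<dots> = (\<Sum>x\<in>nbrs X EG v. M x u)"
    by (intro sum.cong refl) (auto simp: nbrs_def adj_mat_def insert_commute)
  finally show ?thesis using adj_outside[OF _ v, of u] u X_sub by auto
qed

text \<open>If \<open>\<sigma> i\<close> were the only neighbour of \<open>v\<close> in
  \<open>X\<close>, the entries of \<open>EH\<close> between \<open>X\<close> and \<open>v\<close>
  would be row \<open>i\<close> of \<open>Q\<close> up to a common sign.\<close>

lemma two_nbrs_in_X: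
  assumes v: "v \<in> V - X" and ne: "nbrs X EG v \<noteq> {}"
  shows "2 \<le> card (nbrs X EG v)"
proof (rule ccontr)
  assume "\<not> 2 \<le> card (nbrs X EG v)"
  moreover have "finite (nbrs X EG v)"
    using finV X_sub by (auto simp: nbrs_def intro: finite_subset)
  then have "card (nbrs X EG v) \<noteq> 0" using ne by simp
  ultimately have "card (nbrs X EG v) = 1" by linarith
  then obtain y where y: "nbrs X EG v = {y}" by (auto simp: card_1_singleton_iff)
  then have "y \<in> X" by (auto simp: nbrs_def)
  then obtain i where i: "i < k" "y = \<sigma> i" using bij by (auto simp: bij_betw_def)
  have "Q i j \<in> \<int>" if j: "j < k" for j
  proof -
    have "\<sigma> j \<in> X" using j bij by (auto simp: bij_betw_def)
    then have "adj_mat EH (\<sigma> j) v = Q i j * M v v"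
      using adj_X_outside[OF _ v] y i j M_on_X by simp
    then have "Q i j = adj_mat EH (\<sigma> j) v \<or> Q i j = - adj_mat EH (\<sigma> j) v"
      using M_sign[OF v] by auto
    then show ?thesis by (auto simp: adj_mat_def)
  qed
  then show False using no_int i by (auto simp: no_integral_rows_def integral_row_def)
qed

end


section \<open>Isomorphism of G and H in the sparse case\<close>

lemma (in switching) isomorphic_if_sparse:
  assumes conn: "connected_graph V EG" and min_deg: "min_degree_ge V EG 2"
    and G: "simple_graph V EG" and H: "simple_graph V EH"
    and sparse: "\<And>S F. S \<subseteq> V \<Longrightarrow> F \<subseteq> EG \<Longrightarrow> \<forall>e\<in>F. e \<subseteq> S \<Longrightarrow> card S \<le> 2 * k + 1 \<Longrightarrow> card F \<le> card S"
  shows "graph_isomorphic V EG EH"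
proof -
  define W where "W = {v \<in> V - X. nbrs X EG v \<noteq> {}}"
  define U where "U = X \<union> W"
  have finX: "finite X" and finW: "finite W" and finU: "finite U"
    using finV X_sub by (auto simp: U_def W_def intro: finite_subset)
  have XW: "X \<inter> W = {}" and U_sub: "X \<subseteq> U" "U \<subseteq> V" and W_U: "W \<subseteq> U" using X_sub by (auto simp: U_def W_def)
  have pairs: "\<forall>e\<in>EG. \<exists>a b. a \<noteq> b \<and> e = {a, b}"
    using simple_graph_edge[OF G] by blast
  have in_V: "v \<in> V" if "{u, v} \<in> EG" for u v
    using simple_graph_edge[OF G that] by (auto simp: doubleton_eq_iff)
  have two_W: "2 \<le> card (nbrs X EG w)" if "w \<in> W" for w
    using that two_nbrs_in_X by (simp add: W_def)
  have "card W \<le> k"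
  proof (rule ccontr)
    assume "\<not> card W \<le> k"
    \<comment> \<open>The size \<open>k + 1\<close> gives at least \<open>2 * k + 2\<close> edges on
      at most \<open>2 * k + 1\<close> vertices.\<close>
    then obtain Y where Y: "Y \<subseteq> W" "card Y = k + 1"
      using obtain_subset_with_card_n[of "k + 1" W] by (metis Suc_eq_plus1 not_less_eq_eq)
    have finY: "finite Y" and XY: "X \<inter> Y = {}" using Y finW XW finite_subset by auto
    have "2 * card Y \<le> card {e \<in> EG. e \<subseteq> X \<union> Y}"
      using two_W Y by (intro card_edges_ge_bipartite finX finY XY) auto
    also have "\<dots> \<le> card (X \<union> Y)"
      using Y U_sub W_U card_Un_le[of X Y] card_X by (intro sparse) auto
    also have "\<dots> \<le> 2 * k + 1" using card_Un_le[of X Y] Y card_X by simp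
    finally show False using Y by simp
  qed
  then have card_U: "card U \<le> 2 * k + 1" using card_Un_le[of X W] card_X by (simp add: U_def)
  \<comment> \<open>Any vertex adjacent to \<open>X\<close> lies in \<open>X\<close> or in
    \<open>W\<close>, so passing to \<open>U\<close> keeps the degrees on \<open>X\<close>.\<close>
  have nbrs_X: "nbrs U EG x = nbrs V EG x" if x: "x \<in> X" for x
    using x U_sub by (auto simp: nbrs_def U_def W_def insert_commute)
  interpret G: two_regular U EG
  proof (rule two_regular_of_few_edges[OF finU pairs])
    show "2 \<le> card (nbrs U EG u)" if u: "u \<in> U" for u
    proof (cases "u \<in> X")
      case True
      have "degree V EG u = card (nbrs V EG u)"
        by (simp add: degree_def nbrs_def insert_commute)
      moreover have "2 \<le> degree V EG u" using min_deg True X_sub by (auto simp: min_degree_ge_def)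
      ultimately show ?thesis by (simp add: nbrs_X[OF True])
    next
      case False
      then have "2 \<le> card (nbrs X EG u)" using u two_W by (simp add: U_def)
      also have "\<dots> \<le> card (nbrs U EG u)"
        using finU U_sub by (intro card_mono) (auto simp: nbrs_def)
      finally show ?thesis .
    qed
    show "card {e \<in> EG. e \<subseteq> U} \<le> card U" using U_sub card_U by (intro sparse) auto
  qed
  interpret oc: orth_congr U M "adj_mat EG" "adj_mat EH" by (rule orth_congr_on[OF U_sub])
  have "{u} \<notin> EH" for u using simple_graph_edge[OF H, of "{u}"] by auto
  then interpret H: two_regular U EH
    by (rule two_regular_congr[OF G.two_regular_axioms oc.orth_congr_axioms])
  interpret two_regular_pair U EG EH ..
  \<comment> \<open>A cycle inside \<open>X\<close> contains all neighbours of its vertices, so by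
    connectedness it is the whole graph.\<close>
  have range_V: "range c = V" if c: "G.walk c" and cX: "range c \<subseteq> X" for c
  proof
    show "range c \<subseteq> V" using cX X_sub by blast
    show "V \<subseteq> range c"
    proof
      fix v assume "v \<in> V"
      then have "(c 0, v) \<in> (adj_rel EG)\<^sup>*"
        using conn cX X_sub by (auto simp: connected_graph_def)
      then show "v \<in> range c"
      proof (induction rule: rtrancl_induct)
        case (step y z)
        then obtain i where y: "y = c i" by blast
        have "z \<in> nbrs V EG (c i)" using step(2) in_V by (auto simp: adj_rel_def nbrs_def y)
        then have "z \<in> nbrs U EG (c i)" using nbrs_X[of "c i"] cX by auto
        then show ?case using G.walk_nbrs[OF c, of i] by auto
      qed simp
    qed
  qed
  show ?thesis
  proof (cases "X = V")
    case True
    then have U: "U = V" using U_sub by blast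
    obtain v where "v \<in> U" using conn U by (auto simp: connected_graph_def)
    then obtain c where c: "G.walk c" using G.walk_exists by blast
    then have "range c = U" using range_V[OF c] G.walk_in[OF c] U True by auto
    from iso_of_equal_traces[OF c this oc.cheb_trace[symmetric]] show ?thesis
      unfolding U graph_isomorphic_def by metis
  next
    case False
    have nat_meet: "c (int n) = w \<or> c (- int n) = w \<longleftrightarrow> d (int n) = w \<or> d (- int n) = w"
      if c: "G.walk c" and d: "H.walk d" and 0: "c 0 = d 0" "c 0 \<in> W" and w: "w \<in> W" for c d w n
    proof -
      have wU: "w \<in> U" "c 0 \<in> U" and wV: "w \<in> V - X" "c 0 \<in> V - X"
        using 0 w W_U by (auto simp: W_def)
      have "cheb U (adj_mat EH) n w (c 0) = M w w * M (c 0) (c 0) * cheb U (adj_mat EG) n w (c 0)"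
        unfolding oc.congr_cheb[OF wU] using wU wV by (intro oc.congr_entry) (auto simp: M_diag)
      \<comment> \<open>Signs do not affect vanishing, and a sum of two indicators vanishes exactly
        when \<open>w\<close> is at neither position.\<close>
      then have "cheb U (adj_mat EH) n w (c 0) = 0 \<longleftrightarrow> cheb U (adj_mat EG) n w (c 0) = 0"
        using M_sign[OF wV(1)] M_sign[OF wV(2)] by auto
      then show ?thesis
        unfolding G.cheb_walk[OF c wU(1)] unfolding 0(1) H.cheb_walk[OF d wU(1)]
        by (auto simp: of_bool_def split: if_splits)
    qed
    interpret anchored_pair U EG EH W
    proof
      show "W \<subseteq> U" by fact
      show "c j = w \<or> c (- j) = w \<longleftrightarrow> d j = w \<or> d (- j) = w"
        if "G.walk c" "H.walk d" "c 0 = d 0" "c 0 \<in> W" "w \<in> W" for c d w j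
        using nat_meet[OF that, of "nat \<bar>j\<bar>"] by (cases "j \<ge> 0") auto
    qed
    have "range c \<inter> W \<noteq> {}" if c: "G.walk c" for c
    proof
      assume "range c \<inter> W = {}"
      then have "range c \<subseteq> X" using G.walk_in[OF c] by (fastforce simp: U_def)
      then show False using range_V[OF c] False X_sub by blast
    qed
    then obtain f where f: "bij_betw f U U" "\<forall>u\<in>U. \<forall>v\<in>U. {u, v} \<in> EG \<longleftrightarrow> {f u, f v} \<in> EH"
      "\<And>w. w \<in> W \<Longrightarrow> f w = w"
      using anchored_iso by metis
    have f_X: "f x \<in> X" if x: "x \<in> X" for x
    proof (rule ccontr)
      assume "f x \<notin> X"
      then have "f x \<in> W" using f(1) x U_sub by (auto simp: bij_betw_def U_def)
      then have "f (f x) = f x" using f(3) by blast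
      then have "f x = x"
        using f(1) x U_sub(1) \<open>f x \<in> W\<close> W_U by (meson bij_betw_imp_inj_on inj_onD subsetD)
      then show False using \<open>f x \<in> W\<close> x XW by auto
    qed
    \<comment> \<open>By the choice of \<open>W\<close>, a vertex outside \<open>U\<close> has no
      neighbour in \<open>X\<close>; the sum giving its entries in \<open>EH\<close> is then
      empty.\<close>
    have no_edge: "{x, v} \<notin> EG" "{x, v} \<notin> EH" if x: "x \<in> X" and v: "v \<in> V - U" for x v
    proof -
      have vX: "v \<in> V - X" and nv: "nbrs X EG v = {}" using v by (auto simp: U_def W_def)
      show "{x, v} \<notin> EG" using nv x by (auto simp: nbrs_def insert_commute)
      show "{x, v} \<notin> EH" using adj_X_outside[OF x vX] nv by (simp add: adj_mat_def split: if_splits)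
    qed
    define g where "g v = (if v \<in> U then f v else v)" for v
    have "bij_betw g (U \<union> (V - U)) (U \<union> (V - U))"
    proof (rule bij_betw_combine)
      show "bij_betw g U U" using f(1) by (simp add: g_def cong: bij_betw_cong)
      show "bij_betw g (V - U) (V - U)" by (auto simp: g_def bij_betw_def inj_on_def)
    qed simp
    then have "bij_betw g V V" using U_sub by (simp add: Un_absorb1)
    moreover have mixed: "{u, v} \<in> EG \<longleftrightarrow> {g u, v} \<in> EH" if u: "u \<in> U" and v: "v \<in> V - U" for u v
    proof (cases "u \<in> X")
      case True
      then show ?thesis using no_edge v f_X u by (simp add: g_def)
    next
      case False
      then have "u \<in> W" using u by (simp add: U_def)
      then show ?thesis using edge_outside_iff[of u v] f(3) u v U_sub False by (auto simp: g_def)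
    qed
    have "{u, v} \<in> EG \<longleftrightarrow> {g u, g v} \<in> EH" if uv: "u \<in> V" "v \<in> V" for u v
    proof -
      consider "u \<in> U" "v \<in> U" | "u \<in> U" "v \<notin> U" | "u \<notin> U" "v \<in> U" | "u \<notin> U" "v \<notin> U" by blast
      then show ?thesis
      proof cases
        case 1
        then show ?thesis using f(2) by (simp add: g_def)
      next
        case 2
        then show ?thesis using mixed[of u v] uv by (simp add: g_def)
      next
        case 3
        then show ?thesis using mixed[of v u] uv by (simp add: g_def insert_commute)
      next
        case 4
        then show ?thesis using edge_outside_iff[of u v] uv U_sub by (auto simp: g_def)
      qed
    qed
    ultimately show ?thesis unfolding graph_isomorphic_def by blast
  qed
qed

theorem theorem3p1:
  fixes V :: "'a set" and EG EH :: "'a set set" and k :: nat and Q :: "nat \<Rightarrow> nat \<Rightarrow> real"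
  assumes "simple_graph V EG"
    and "card V \<ge> k"
    and "connected_graph V EG"
    and "min_degree_ge V EG 2"
    and "orthogonal_mat k Q"
    and "no_integral_rows k Q"
    and "simple_graph V EH"
    and "\<not> graph_isomorphic V EG EH"
    and "Q_switching k Q V EG EH"
  shows "\<exists>S F. S \<subseteq> V \<and> F \<subseteq> EG \<and> (\<forall>e\<in>F. e \<subseteq> S) \<and> connected_graph S F \<and>
               card S \<le> 2 * k + 1 \<and> card F > card S"
proof (rule ccontr)
  let ?dense = "\<exists>S F. S \<subseteq> V \<and> F \<subseteq> EG \<and> (\<forall>e\<in>F. e \<subseteq> S) \<and> connected_graph S F \<and>
    card S \<le> 2 * k + 1 \<and> card F > card S"
  assume no_dense: "\<not> ?dense"
  have finV: "finite V" and pairs: "\<forall>e\<in>EG. \<exists>a b. e = {a, b}"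
    using assms(1) simple_graph_edge[OF assms(1)] by (simp add: simple_graph_def, blast)
  \<comment> \<open>The bound must also cover disconnected subgraphs; a dense one contains a
    connected dense one that is no larger.\<close>
  have sparse: "card F \<le> card S"
    if SF: "S \<subseteq> V" "F \<subseteq> EG" "\<forall>e\<in>F. e \<subseteq> S" "card S \<le> 2 * k + 1" for S F
  proof (rule ccontr)
    assume "\<not> card F \<le> card S"
    moreover have finS: "finite S" using SF finV finite_subset by blast
    moreover have "\<forall>e\<in>F. \<exists>a b. e = {a, b}" using SF(2) pairs by blast
    ultimately obtain S' F' where *: "S' \<subseteq> S" "F' \<subseteq> F" "\<forall>e\<in>F'. e \<subseteq> S'" "connected_graph S' F'"
      "card S' < card F'"
      using dense_connected_subgraph[of S F] SF(3) by auto
    moreover have "card S' \<le> 2 * k + 1" using card_mono[OF finS *(1)] SF(4) by linarith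
    ultimately have ?dense using SF(1,2) by (intro exI[of _ S'] exI[of _ F'] conjI) auto
    then show False using no_dense by contradiction
  qed
  obtain X \<sigma> A B where sw: "X \<subseteq> V" "card X = k" "bij_betw \<sigma> {..<k} X" "A \<union> B = V - X"
    "\<forall>u\<in>V. \<forall>w\<in>V. adj_mat EH u w = congr_mat V (switch_mat Q X \<sigma> A B) (adj_mat EG) u w"
    using assms(9) unfolding Q_switching_def congr_mat_def by blast
  then interpret switching V X A B EG EH k Q \<sigma>
    using finV assms(5,6) by unfold_locales auto
  show False using isomorphic_if_sparse[OF assms(3,4,1,7) sparse] assms(8) by blast
qed

end
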